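(* Let $n\ge 2$, let $\lambda=(\lambda_1,\dots,\lambda_n)\in\mathbb{R}^n$ satisfy $1>\lambda_1>\lambda_2>\cdots>\lambda_n$ and $\lambda_1>\max_{2\le \ell\le n}|\lambda_\ell|$, and let $\beta=(\beta_1,\dots,\beta_n)\in\mathbb{R}^n$ satisfy $\sum_{\ell=1}^n\beta_\ell=1$ and $\prod_{\ell=1}^n\beta_\ell\ne 0$. Let $\{(A_\ell,P_\ell):\ell\ge 0\}$ be any sequence generated by the alternating minimization algorithm (described in the context) applied to the problem $(\mathbf{OP})$, starting from an arbitrary entrywise nonnegative $A_0\in\mathbb{R}^{n\times n}$ with $A_0\mathbf{1}^\top\le\mathbf{1}^\top$. Then: (i) The sequence $\{\mathcal{L}(A_\ell,P_\ell):\ell\ge 0\}$ has a finite limit, denoted $\mathcal{L}_\infty$. (ii) The sequence $\{(A_\ell,P_\ell):\ell\ge 0\}$ has at least one limit point, and any limit point $(A_\infty,P_\infty)$ of it satisfies the KKT conditions of $(\mathbf{OP})$ (written out in the context). Further, $\mathcal{L}(A_\infty,P_\infty)=\mathcal{L}_\infty$. (iii) No limit point of $\{(A_\ell,P_\ell):\ell\ge 0\}$ is a local maximum of $(\mathbf{OP})$, i.e. a local maximum of $\mathcal{L}$ over the feasible set of $(\mathbf{OP})$.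
   Context: Vectors are row vectors; $\mathbf{1}$ is the all-ones vector, $\mathbf{0}$ the zero vector; vector inequalities are componentwise; $\|\cdot\|_F$ is the Frobenius norm; $\mathrm{diag}(\lambda)$ is the diagonal matrix with diagonal entries $\lambda_1,\dots,\lambda_n$. For $A=(a_{ij}),P=(p_{ij})\in\mathbb{R}^{n\times n}$ set $$\mathcal{L}(A,P)=\|PA-\mathrm{diag}(\lambda)P\|_F^2 .$$ Problem $(\mathbf{OP})$: minimize $\mathcal{L}(A,P)$ over $(A,P)\in\mathbb{R}^{n\times n}\times\mathbb{R}^{n\times n}$ subject to $P\mathbf{1}^\top=\mathbf{1}^\top$, $\beta P\ge\mathbf{0}$, $A$ entrywise nonnegative, $A\mathbf{1}^\top\le\mathbf{1}^\top$. Problem $(\mathbf{OP}[A])$ (for fixed $A$): minimize $\mathcal{L}(A,P)$ over $P\in\mathbb{R}^{n\times n}$ subject to $P\mathbf{1}^\top=\mathbf{1}^\top$, $\beta P\ge\mathbf{0}$. Problem $(\mathbf{OP}[P])$ (for fixed $P$): minimize $\mathcal{L}(A,P)$ over $A\in\mathbb{R}^{n\times n}$ subject to $A$ entrywise nonnegative, $A\mathbf{1}^\top\le\mathbf{1}^\top$. Alternating minimization algorithm: choose an entrywise nonnegative $A_0\in\mathbb{R}^{n\times n}$ with $A_0\mathbf{1}^\top\le\mathbf{1}^\top$. For each $\ell\ge0$, let $P_\ell$ be an (arbitrary) optimal solution of $(\mathbf{OP}[A])$ with $A=A_\ell$; then let $A_{\ell+1}$ be an (arbitrary) optimal solution of $(\mathbf{OP}[P])$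 with $P=P_\ell$. (Optimal solutions of these subproblems exist.) KKT conditions of $(\mathbf{OP})$ at $(A,P)$: there exist real multipliers $\alpha_i$, $\widetilde\alpha_j$, $\pi_i$, $\widetilde\pi_{ij}$ ($1\le i,j\le n$) such that (a) $\frac{\partial}{\partial p_{ij}}\mathcal{L}(A,P)+\alpha_i-\widetilde\alpha_j\beta_i=0$ for $1\le i,j\le n$; $P\mathbf{1}^\top=\mathbf{1}^\top$; $\beta P\ge\mathbf{0}$; $\widetilde\alpha_j\big(\sum_{\ell=1}^n\beta_\ell p_{\ell j}\big)=0$ and $\widetilde\alpha_j\ge0$ for $1\le j\le n$; (b) $\frac{\partial}{\partial a_{ij}}\mathcal{L}(A,P)+\pi_i-\widetilde\pi_{ij}=0$ for $1\le i,j\le n$; $A\mathbf{1}^\top\le\mathbf{1}^\top$; $\pi_i\big(\sum_{\ell=1}^n a_{i\ell}-1\big)=0$ for $1\le i\le n$; $A$ is entrywise nonnegative; $\widetilde\pi_{ij}a_{ij}=0$ for $1\le i,j\le n$; $\pi_i\ge0$ and $\widetilde\pi_{ij}\ge0$ for all $i,j$. A limit point of a sequence is the limit of some convergent subsequence. *)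

theory Defs
  imports "HOL-Analysis.Analysis"
begin

definition diag :: "real ^ 'n \<Rightarrow> real ^ 'n ^ 'n" where
  "diag v = (\<chi> i j. if i = j then v $ i else 0)"

(* The norm of the type real ^ 'n ^ 'n is the Frobenius norm (not the operator norm): *)
lemma norm_matrix_eq_Frobenius:
  fixes M :: "real ^ 'n ^ 'm"
  shows "(norm M)\<^sup>2 = (\<Sum>i\<in>UNIV. \<Sum>j\<in>UNIV. (M $ i $ j)\<^sup>2)"
  by (simp add: norm_vec_def L2_set_def sum_nonneg)

definition objective :: "real ^ 'n \<Rightarrow> real ^ 'n ^ 'n \<Rightarrow> real ^ 'n ^ 'n \<Rightarrow> real" where
  "objective lam A P = (norm (P ** A - diag lam ** P))\<^sup>2"

(* Below, 1 :: real ^ 'n is the all-ones vector, *v multiplies by a column vector and v* by a row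
   vector, and the order on vectors and matrices is the componentwise one. *)

definition feasible_P :: "real ^ 'n \<Rightarrow> real ^ 'n ^ 'n \<Rightarrow> bool" where
  "feasible_P \<beta> P \<longleftrightarrow> P *v 1 = 1 \<and> 0 \<le> \<beta> v* P"

definition feasible_A :: "real ^ 'n ^ 'n \<Rightarrow> bool" where
  "feasible_A A \<longleftrightarrow> 0 \<le> A \<and> A *v 1 \<le> 1"

definition feasible_OP :: "real ^ 'n \<Rightarrow> ((real ^ 'n ^ 'n) \<times> (real ^ 'n ^ 'n)) set" where
  "feasible_OP \<beta> = {(A, P). feasible_A A \<and> feasible_P \<beta> P}"

definition optimal_P :: "real ^ 'n \<Rightarrow> real ^ 'n \<Rightarrow> real ^ 'n ^ 'n \<Rightarrow> real ^ 'n ^ 'n \<Rightarrow> bool" where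
  "optimal_P lam \<beta> A P \<longleftrightarrow> is_arg_min (\<lambda>P. objective lam A P) (feasible_P \<beta>) P"

definition optimal_A :: "real ^ 'n \<Rightarrow> real ^ 'n ^ 'n \<Rightarrow> real ^ 'n ^ 'n \<Rightarrow> bool" where
  "optimal_A lam P A \<longleftrightarrow> is_arg_min (\<lambda>A. objective lam A P) feasible_A A"

definition alternating_minimization ::
  "real ^ 'n \<Rightarrow> real ^ 'n \<Rightarrow> (nat \<Rightarrow> real ^ 'n ^ 'n) \<Rightarrow> (nat \<Rightarrow> real ^ 'n ^ 'n) \<Rightarrow> bool" where
  "alternating_minimization lam \<beta> A P \<longleftrightarrow>
     feasible_A (A 0) \<and>
     (\<forall>l. optimal_P lam \<beta> (A l) (P l) \<and> optimal_A lam (P l) (A (Suc l)))"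

(* Partial derivative of f at M with respect to the (i, j) entry. *)
definition entry_deriv :: "(real ^ 'n ^ 'm \<Rightarrow> real) \<Rightarrow> real ^ 'n ^ 'm \<Rightarrow> 'm \<Rightarrow> 'n \<Rightarrow> real" where
  "entry_deriv f M i j =
     deriv (\<lambda>t. f (\<chi> k l. if k = i \<and> l = j then t else M $ k $ l)) (M $ i $ j)"

(* deriv is a total operator; the derivatives used below do exist: *)
lemma objective_entry_differentiable:
  "(\<lambda>t. objective lam A (\<chi> k l. if k = i \<and> l = j then t else P $ k $ l)) field_differentiable at x"
  "(\<lambda>t. objective lam (\<chi> k l. if k = i \<and> l = j then t else A $ k $ l) P) field_differentiable at x"
proof -
  have entry: "(\<lambda>t. if b then t else (c::real)) field_differentiable at x" for b c
    by (cases b) (auto intro: field_differentiable_ident field_differentiable_const)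
  have sq: "(\<lambda>t. (f t)\<^sup>2) field_differentiable at x"
    if "f field_differentiable at x" for f :: "real \<Rightarrow> real"
    using field_differentiable_mult[OF that that] by (simp add: power2_eq_square)
  show "(\<lambda>t. objective lam A (\<chi> k l. if k = i \<and> l = j then t else P $ k $ l))
          field_differentiable at x"
    "(\<lambda>t. objective lam (\<chi> k l. if k = i \<and> l = j then t else A $ k $ l) P)
          field_differentiable at x"
    unfolding objective_def norm_matrix_eq_Frobenius
    by (simp_all add: matrix_matrix_mult_def)
       (intro field_differentiable_sum sq field_differentiable_diff field_differentiable_mult
          entry field_differentiable_const)+
qed

definition KKT_OP :: "real ^ 'n \<Rightarrow> real ^ 'n \<Rightarrow> real ^ 'n ^ 'n \<Rightarrow> real ^ 'n ^ 'n \<Rightarrow> bool" where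
  "KKT_OP lam \<beta> A P \<longleftrightarrow>
     (\<exists>(\<alpha> :: real ^ 'n) (\<alpha>' :: real ^ 'n) (\<pi> :: real ^ 'n) (\<pi>' :: real ^ 'n ^ 'n).
        (\<forall>i j. entry_deriv (\<lambda>P. objective lam A P) P i j + \<alpha> $ i - \<alpha>' $ j * \<beta> $ i = 0) \<and>
        P *v 1 = 1 \<and> 0 \<le> \<beta> v* P \<and>
        (\<forall>j. \<alpha>' $ j * (\<Sum>l\<in>UNIV. \<beta> $ l * P $ l $ j) = 0 \<and> 0 \<le> \<alpha>' $ j) \<and>
        (\<forall>i j. entry_deriv (\<lambda>A. objective lam A P) A i j + \<pi> $ i - \<pi>' $ i $ j = 0) \<and>
        A *v 1 \<le> 1 \<and>
        (\<forall>i. \<pi> $ i * ((\<Sum>l\<in>UNIV. A $ i $ l) - 1) = 0) \<and>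
        0 \<le> A \<and>
        (\<forall>i j. \<pi>' $ i $ j * A $ i $ j = 0) \<and>
        (\<forall>i. 0 \<le> \<pi> $ i) \<and> (\<forall>i j. 0 \<le> \<pi>' $ i $ j))"

definition limit_point_of :: "'a::topological_space \<Rightarrow> (nat \<Rightarrow> 'a) \<Rightarrow> bool" where
  "limit_point_of x X \<longleftrightarrow> (\<exists>r. strict_mono (r :: nat \<Rightarrow> nat) \<and> (X \<circ> r) \<longlonglongrightarrow> x)"

definition local_max_on :: "('a::metric_space \<Rightarrow> real) \<Rightarrow> 'a set \<Rightarrow> 'a \<Rightarrow> bool" where
  "local_max_on f S x \<longleftrightarrow> x \<in> S \<and> (\<exists>e>0. \<forall>y\<in>S. dist y x < e \<longrightarrow> f y \<le> f x)"

end

(* The residual PA - diag(lam) P is affine in each block, so the objective is a convex quadratic in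
   each block. A recession direction D of a sublevel set for fixed A satisfies D 1 = 0, beta D = 0 and
   DA = diag(lam) D; its rows are left eigenvectors of A for distinct eigenvalues, hence D = 0, and
   compactness of the set of feasible A then bounds the iterates. Passing to the limit in the two
   optimality inequalities shows that a limit point is optimal in each block separately, and the
   linear constraints are simple enough to write the multipliers down in terms of the gradient. At a nonzero D with D 1 = 0 and beta D = 0 the
   average of the objective at P + tD and P - tD exceeds the one at P, so no feasible point is a
   local maximum. *)
theory Submission
  imports Defs
begin

section \<open>Matrix units as coordinate directions, and linearity of the matrix products\<close>

definition matrix_unit :: "'n \<Rightarrow> 'n \<Rightarrow> real ^ 'n::finite ^ 'n" where
  "matrix_unit i j = (\<chi> k l. if k = i \<and> l = j then 1 else 0)"

lemma matrix_unit_nth: "matrix_unit i j $ k $ l = (if k = i \<and> l = j then 1 else 0)"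
  by (simp add: matrix_unit_def)

lemma matrix_unit_mult_one: "matrix_unit i j *v 1 = (axis i 1 :: real ^ 'n::finite)"
  by (auto simp: vec_eq_iff matrix_vector_mult_def axis_def matrix_unit_nth)

lemma vector_mult_matrix_unit: "\<beta> v* matrix_unit i j = \<beta> $ i *\<^sub>R (axis j 1 :: real ^ 'n::finite)"
  by (auto simp: vec_eq_iff vector_matrix_mult_def axis_def matrix_unit_nth if_distrib if_distribR cong: if_cong)

lemma linear_matrix_vector_mult_left: "linear (\<lambda>D. D *v (v :: real ^ 'n::finite) :: real ^ 'n)"
  by (rule linearI)
     (simp_all add: vec_eq_iff matrix_vector_mult_def sum.distrib sum_distrib_left algebra_simps)

lemma linear_vector_matrix_mult_right: "linear (\<lambda>D. \<beta> v* D :: real ^ 'n::finite)"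
  by (rule linearI)
     (simp_all add: vec_eq_iff vector_matrix_mult_def sum.distrib sum_distrib_left algebra_simps)

lemma linear_matrix_mult_left: "linear (\<lambda>P. P ** A :: real ^ 'n::finite ^ 'n)"
  by (rule linearI)
     (simp_all add: vec_eq_iff matrix_matrix_mult_def sum.distrib sum_distrib_left algebra_simps)

lemma linear_matrix_mult_right: "linear (\<lambda>A. P ** A :: real ^ 'n::finite ^ 'n)"
  by (rule linearI)
     (simp_all add: vec_eq_iff matrix_matrix_mult_def sum.distrib sum_distrib_left algebra_simps)

section \<open>The objective as the square of an affine map\<close>

abbreviation resid :: "real ^ 'n \<Rightarrow> real ^ 'n ^ 'n \<Rightarrow> real ^ 'n ^ 'n \<Rightarrow> real ^ 'n::finite ^ 'n" where
  "resid lam A P \<equiv> P ** A - diag lam ** P"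

lemma linear_resid: "linear (resid lam A)"
  by (intro linear_compose_sub linear_matrix_mult_left linear_matrix_mult_right)

text \<open>Left multiplication by \<open>diag lam\<close> scales each row separately, so a
  vanishing residual turns into one eigenvector equation per row.\<close>

lemma resid_row: "resid lam A P $ i = P $ i v* A - lam $ i *\<^sub>R P $ i"
proof -
  have "(\<Sum>k\<in>UNIV. (if i = k then lam $ i else 0) * P $ k $ j) = lam $ i * P $ i $ j" for j
    by (subst sum.mono_neutral_right[of _ "{i}"]) auto
  then show ?thesis
    by (simp add: vec_eq_iff matrix_matrix_mult_def vector_matrix_mult_def diag_def mult.commute)
qed

lemma continuous_on_resid:
  "continuous_on S (\<lambda>(A, P). resid lam A P)"
  unfolding matrix_matrix_mult_def case_prod_beta
  by (intro continuous_intros)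

text \<open>\<open>T\<close> is affine with linear part \<open>S\<close>, so its squared norm along
  a line is a quadratic polynomial in \<open>t\<close>. The linear coefficient is the directional
  derivative; the quadratic one later excludes local maxima.\<close>

lemma norm_square_affine:
  assumes "linear S" and "\<And>X D. T (X + D) = T X + S D"
  shows "(norm (T (X + t *\<^sub>R D) :: 'b :: real_inner))\<^sup>2
       = (norm (T X))\<^sup>2 + t * (2 * (T X \<bullet> S D)) + t\<^sup>2 * (norm (S D))\<^sup>2"
  unfolding assms(2) linear_scale[OF assms(1)]
  by (simp only: power2_norm_eq_inner inner_add_left inner_add_right inner_scaleR_left inner_scaleR_right)
     (simp add: inner_commute power2_eq_square algebra_simps)

text \<open>Varying one entry means moving along a matrix unit, so the derivative is the linear
  coefficient of the quadratic polynomial.\<close>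

lemma entry_deriv_norm_square:
  fixes T S :: "real ^ 'n::finite ^ 'n \<Rightarrow> 'b :: real_inner"
  assumes "linear S" and "\<And>X D. T (X + D) = T X + S D"
  shows "entry_deriv (\<lambda>X. (norm (T X))\<^sup>2) X i j = 2 * (T X \<bullet> S (matrix_unit i j))"
proof -
  have *: "(\<chi> k l. if k = i \<and> l = j then t else X $ k $ l) = X + (t - X $ i $ j) *\<^sub>R matrix_unit i j" for t
    by (auto simp: vec_eq_iff matrix_unit_nth)
  have "((\<lambda>t. (norm (T (X + (t - X $ i $ j) *\<^sub>R matrix_unit i j)))\<^sup>2)
     has_field_derivative 2 * (T X \<bullet> S (matrix_unit i j))) (at (X $ i $ j))"
    unfolding norm_square_affine[OF assms]
    by (auto intro!: derivative_eq_intros)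
  then show ?thesis
    unfolding entry_deriv_def * by (rule DERIV_imp_deriv)
qed

text \<open>A negative linear coefficient would outweigh the quadratic term for small steps.
  Convexity allows the step to be shortened, so \<open>t\<close> may be of any size.\<close>

lemma first_order_condition:
  fixes T S :: "'a :: real_vector \<Rightarrow> 'b :: real_inner"
  assumes S: "linear S" and T: "\<And>X D. T (X + D) = T X + S D"
    and C: "convex C" "X \<in> C" and min: "\<And>Y. Y \<in> C \<Longrightarrow> (norm (T X))\<^sup>2 \<le> (norm (T Y))\<^sup>2"
    and t: "0 < t" "X + t *\<^sub>R D \<in> C"
  shows "0 \<le> T X \<bullet> S D"
proof (rule ccontr)
  define a where "a = - (T X \<bullet> S D)"
  define q where "q = (norm (S D))\<^sup>2"
  assume "\<not> 0 \<le> T X \<bullet> S D"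
  then have a: "0 < a" by (simp add: a_def)
  \<comment> \<open>The bound \<open>t\<close> keeps the new point on a segment inside
    \<open>C\<close>; the bound \<open>a / (q + 1)\<close> makes the quadratic term smaller than the
    linear gain. The added 1 avoids division by zero when \<open>S D = 0\<close>.\<close>
  define s where "s = min t (a / (q + 1))"
  have q: "0 \<le> q" by (simp add: q_def)
  have s: "0 < s" "s \<le> t" "s \<le> a / (q + 1)" using a q t(1) by (auto simp: s_def)
  have "s * (q + 1) \<le> a" using s(3) q by (simp add: field_simps)
  then have "s * q < 2 * a" using s(1) a by (simp add: algebra_simps)
  then have "s * (s * q) < s * (2 * a)" using s(1) by simp
  have "(1 - s / t) *\<^sub>R X + (s / t) *\<^sub>R (X + t *\<^sub>R D) \<in> C"
    using s t C by (intro convexD) auto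
  also have "(1 - s / t) *\<^sub>R X + (s / t) *\<^sub>R (X + t *\<^sub>R D) = X + s *\<^sub>R D"
    using t(1) by (simp add: algebra_simps)
  finally have "(norm (T X))\<^sup>2 \<le> (norm (T (X + s *\<^sub>R D)))\<^sup>2" by (rule min)
  then show False
    using \<open>s * (s * q) < s * (2 * a)\<close>
    unfolding norm_square_affine[OF S T] by (simp add: a_def q_def power2_eq_square algebra_simps)
qed

section \<open>Feasible sets\<close>

lemma feasible_A_iff:
  "feasible_A A \<longleftrightarrow> (\<forall>i j. 0 \<le> A $ i $ j) \<and> (\<forall>i. (\<Sum>j\<in>UNIV. A $ i $ j) \<le> 1)"
  by (simp add: feasible_A_def less_eq_vec_def matrix_vector_mult_def)

lemma feasible_P_iff:
  "feasible_P \<beta> P \<longleftrightarrow>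
     (\<forall>i. (\<Sum>j\<in>UNIV. P $ i $ j) = 1) \<and> (\<forall>j. 0 \<le> (\<Sum>i\<in>UNIV. \<beta> $ i * P $ i $ j))"
  by (simp add: feasible_P_def less_eq_vec_def matrix_vector_mult_def vector_matrix_mult_def
      vec_eq_iff mult.commute)

lemma vector_matrix_mult_nth:
  "(\<beta> v* P) $ j = (\<Sum>i\<in>UNIV. \<beta> $ i * P $ i $ j :: 'a :: comm_semiring_1)"
  by (simp add: vector_matrix_mult_def mult.commute)

lemma feasible_P_nonneg: "feasible_P \<beta> P \<Longrightarrow> 0 \<le> (\<beta> v* P) $ j"
  by (simp add: feasible_P_def less_eq_vec_def)

text \<open>Interchanging the sums weights the row sums of \<open>P\<close> by \<beta>. Together
  with nonnegativity this makes \<open>\<beta> v* P\<close> a probability vector, even when \<beta>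
  has negative entries.\<close>

lemma feasible_P_sum_one:
  assumes "feasible_P \<beta> P" and "(\<Sum>i\<in>UNIV. \<beta> $ i) = 1"
  shows "(\<Sum>j\<in>UNIV. (\<beta> v* P) $ j) = 1"
proof -
  have "(\<Sum>j\<in>UNIV. (\<beta> v* P) $ j) = (\<Sum>i\<in>UNIV. \<beta> $ i * (\<Sum>j\<in>UNIV. P $ i $ j))"
    unfolding vector_matrix_mult_nth sum_distrib_left by (rule sum.swap)
  then show ?thesis
    using assms by (simp add: feasible_P_iff)
qed

lemma convex_feasible_A: "convex {A. feasible_A A}"
  unfolding convex_def
  by (auto simp: feasible_A_iff sum.distrib convex_bound_le simp flip: sum_distrib_left)

lemma convex_feasible_P:
  fixes \<beta> :: "real ^ 'n::finite"
  shows "convex {P. feasible_P \<beta> P}"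
proof -
  have "(\<Sum>i\<in>UNIV. \<beta> $ i * (u * P $ i $ j + v * Q $ i $ j))
      = u * (\<Sum>i\<in>UNIV. \<beta> $ i * P $ i $ j) + v * (\<Sum>i\<in>UNIV. \<beta> $ i * Q $ i $ j)"
    for u v j and P Q :: "real ^ 'n ^ 'n"
    by (simp add: sum_distrib_left sum.distrib algebra_simps)
  then show ?thesis
    unfolding convex_def
    by (auto simp: feasible_P_iff sum.distrib simp flip: sum_distrib_left)
qed

lemma closed_feasible_A: "closed {A. feasible_A A}"
  unfolding feasible_A_iff
  by (intro closed_Collect_conj closed_Collect_all closed_Collect_le continuous_intros)

lemma closed_feasible_P: "closed {P. feasible_P \<beta> P}"
  unfolding feasible_P_iff
  by (intro closed_Collect_conj closed_Collect_all closed_Collect_le closed_Collect_eq continuous_intros)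

lemma compact_feasible_A: "compact {A :: real ^ 'n::finite ^ 'n. feasible_A A}"
proof -
  \<comment> \<open>Here \<open>1\<close> is the all-ones matrix, which dominates every feasible
    \<open>A\<close> entrywise.\<close>
  have "norm A \<le> norm (1 :: real ^ 'n ^ 'n)" if "feasible_A A" for A :: "real ^ 'n ^ 'n"
  proof (intro norm_le_componentwise_cart)
    fix i j
    have "A $ i $ j \<le> (\<Sum>j\<in>UNIV. A $ i $ j)"
      using that by (intro member_le_sum) (auto simp: feasible_A_iff)
    then show "norm (A $ i $ j) \<le> norm ((1 :: real ^ 'n ^ 'n) $ i $ j)"
      using that by (auto simp: feasible_A_iff intro: order_trans)
  qed
  then show ?thesis
    using closed_feasible_A by (auto simp: compact_eq_bounded_closed bounded_iff)
qed

section \<open>Bounded sublevel sets\<close>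

text \<open>The rows of \<open>D\<close> are left eigenvectors of \<open>A\<close> for distinct eigenvalues, so a vanishing
  combination of them with nonzero coefficients forces all of them to vanish.\<close>
lemma resid_kernel_trivial:
  fixes lam \<beta> :: "real ^ 'n::finite"
  assumes inj: "inj (($) lam)" and \<beta>: "\<And>i. \<beta> $ i \<noteq> 0"
    and D: "\<beta> v* D = 0" and ker: "resid lam A D = 0"
  shows "D = 0"
proof -
  have row: "D $ i v* A = lam $ i *\<^sub>R D $ i" for i
    using resid_row[of D A lam i] ker by simp
  have lin: "linear (\<lambda>v. v v* A)"
    by (rule linearI) (simp_all add: vector_matrix_left_distrib scaleR_vector_matrix_assoc)
  \<comment> \<open>Multiplying a combination of the rows by \<open>A\<close> and subtracting
    \<open>lam $ s\<close> times it scales the coefficient of row \<open>i\<close> by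
    \<open>lam $ i - lam $ s\<close>. Starting from \<open>\<beta> v* D = 0\<close>, the induction
    inserts one such factor for each \<open>s\<close>.\<close>
  have comb: "(\<Sum>i\<in>UNIV. ((\<Prod>s\<in>S. lam $ i - lam $ s) * \<beta> $ i) *\<^sub>R D $ i) = 0"
    if "finite S" for S
    using that
  proof (induction S)
    case empty
    then show ?case
      using D by (simp add: vec_eq_iff vector_matrix_mult_def mult.commute)
  next
    case (insert s S)
    let ?c = "\<lambda>i. (\<Prod>s\<in>S. lam $ i - lam $ s) * \<beta> $ i"
    have "(\<Sum>i\<in>UNIV. ((\<Prod>s\<in>insert s S. lam $ i - lam $ s) * \<beta> $ i) *\<^sub>R D $ i)
       = (\<Sum>i\<in>UNIV. ?c i *\<^sub>R D $ i) v* A - lam $ s *\<^sub>R (\<Sum>i\<in>UNIV. ?c i *\<^sub>R D $ i)"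
      using insert.hyps
      by (simp add: linear_sum[OF lin] linear_scale[OF lin] row scaleR_sum_right
          algebra_simps flip: sum_subtractf scaleR_left_diff_distrib)
    then show ?case
      by (simp add: insert.IH linear_0[OF lin])
  qed
  have "D $ i = 0" for i
  proof -
    \<comment> \<open>The factors for all indices other than \<open>i\<close> annihilate every
      coefficient except that of row \<open>i\<close>.\<close>
    let ?c = "\<lambda>k. (\<Prod>s\<in>UNIV - {i}. lam $ k - lam $ s) * \<beta> $ k"
    have "(\<Sum>k\<in>UNIV. ?c k *\<^sub>R D $ k) = ?c i *\<^sub>R D $ i"
      by (subst sum.mono_neutral_right[of _ "{i}"]) auto
    moreover have "?c i \<noteq> 0"
      using inj \<beta> by (auto simp: inj_def)
    ultimately show ?thesis
      using comb[of "UNIV - {i}"] by simp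
  qed
  then show ?thesis
    by (simp add: vec_eq_iff)
qed

text \<open>Feasible \<open>A\<close> and unit \<open>D\<close> with \<open>\<beta> v* D = 0\<close>
  form a compact set on which the residual never vanishes, so its norm has a positive lower bound
  uniform in \<open>A\<close>. Homogeneity in \<open>D\<close> does the rest.\<close>

lemma resid_coercive:
  fixes lam \<beta> :: "real ^ 'n::finite"
  assumes inj: "inj (($) lam)" and \<beta>: "\<And>i. \<beta> $ i \<noteq> 0"
  obtains m where "m > 0"
    "\<And>A D. feasible_A A \<Longrightarrow> \<beta> v* D = 0 \<Longrightarrow> m * norm D \<le> norm (resid lam A D)"
proof -
  let ?K = "{A. feasible_A A} \<times> (sphere 0 1 \<inter> {D :: real ^ 'n ^ 'n. \<beta> v* D = 0})"
  let ?S = "(\<lambda>(A, D). resid lam A D) ` ?K"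
  have "closed {D :: real ^ 'n ^ 'n. \<beta> v* D = 0}"
    unfolding vector_matrix_mult_def
    by (intro closed_Collect_eq continuous_intros)
  then have "compact ?K"
    by (intro compact_Times compact_feasible_A compact_Int_closed compact_sphere)
  then have "closed ?S"
    by (intro compact_imp_closed compact_continuous_image continuous_on_resid)
  moreover have "0 \<notin> ?S"
    using resid_kernel_trivial[OF assms] by force
  ultimately obtain m where m: "m > 0" "\<And>x. x \<in> ?S \<Longrightarrow> m \<le> dist 0 x"
    using separate_point_closed[of ?S 0] by blast
  show ?thesis
  proof (rule that[OF m(1)])
    fix A D :: "real ^ 'n ^ 'n"
    assume A: "feasible_A A" and D: "\<beta> v* D = 0"
    show "m * norm D \<le> norm (resid lam A D)"
    proof (cases "D = 0")
      case False
      let ?D = "(1 / norm D) *\<^sub>R D"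
      have "\<beta> v* ?D = (1 / norm D) *\<^sub>R (\<beta> v* D)"
        by (simp add: vec_eq_iff vector_matrix_mult_def sum_divide_distrib)
      then have "(A, ?D) \<in> ?K"
        using A D False by simp
      then have "m \<le> norm (resid lam A ?D)"
        using m(2)[of "resid lam A ?D"] by force
      also have "\<dots> = norm (resid lam A D) / norm D"
        by (simp add: linear_scale[OF linear_resid])
      finally show ?thesis
        using False by (simp add: field_simps)
    qed simp
  qed
qed

text \<open>A feasible \<open>P\<close> differs from the matrix all of whose rows are \<open>\<beta> v* P\<close>, a probability
  vector, by an element of the subspace on which the residual is coercive.\<close>
lemma bounded_sublevel:
  fixes lam \<beta> :: "real ^ 'n::finite"
  assumes inj: "inj (($) lam)" and \<beta>: "\<And>i. \<beta> $ i \<noteq> 0" and \<beta>1: "(\<Sum>i\<in>UNIV. \<beta> $ i) = 1"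
  shows "bounded {(A, P). feasible_A A \<and> feasible_P \<beta> P \<and> objective lam A P \<le> c}"
proof -
  obtain m where m: "m > 0"
    "\<And>A D. feasible_A A \<Longrightarrow> \<beta> v* D = 0 \<Longrightarrow> m * norm D \<le> norm (resid lam A D)"
    using resid_coercive[OF inj \<beta>] by blast
  \<comment> \<open>The ball contains all matrices with entries in [0,1], among them the comparison
    matrix \<open>Q\<close> below, whose residual is thus bounded by \<open>b\<close> uniformly in
    \<open>A\<close>.\<close>
  let ?K = "{A. feasible_A A} \<times> cball 0 (norm (1 :: real ^ 'n ^ 'n))"
  have "compact ((\<lambda>(A, P). resid lam A P) ` ?K)"
    by (intro compact_continuous_image continuous_on_resid compact_Times compact_feasible_A compact_cball)
  then obtain b where b: "\<And>A Q. (A, Q) \<in> ?K \<Longrightarrow> norm (resid lam A Q) \<le> b"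
    by (force simp: bounded_iff dest!: compact_imp_bounded)
  obtain a where a: "\<And>A :: real ^ 'n ^ 'n. feasible_A A \<Longrightarrow> norm A \<le> a"
    using compact_imp_bounded[OF compact_feasible_A] by (force simp: bounded_iff)
  have "norm P \<le> norm (1 :: real ^ 'n ^ 'n) + (sqrt c + b) / m"
    if A: "feasible_A A" and P: "feasible_P \<beta> P" and c: "objective lam A P \<le> c" for A P
  proof -
    define Q :: "real ^ 'n ^ 'n" where "Q = (\<chi> i. \<beta> v* P)"
    note nonneg = feasible_P_nonneg[OF P] and sum_one = feasible_P_sum_one[OF P \<beta>1]
    have "(\<beta> v* P) $ j \<le> 1" for j
      using member_le_sum[of j UNIV "\<lambda>j. (\<beta> v* P) $ j"] nonneg sum_one by simp
    then have Q: "norm Q \<le> norm (1 :: real ^ 'n ^ 'n)"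
      using nonneg by (auto intro!: norm_le_componentwise_cart simp: Q_def)
    \<comment> \<open>All rows of \<open>Q\<close> agree and \<beta> sums to 1, so the weighted row
      sum of \<open>Q\<close> is that common row \<open>\<beta> v* P\<close>.\<close>
    have "(\<beta> v* Q) $ j = (\<Sum>i\<in>UNIV. \<beta> $ i) * (\<beta> v* P) $ j" for j
      unfolding sum_distrib_right by (subst vector_matrix_mult_def) (simp add: Q_def mult.commute)
    then have "\<beta> v* (P - Q) = 0"
      using \<beta>1 by (simp add: linear_diff[OF linear_vector_matrix_mult_right] vec_eq_iff)
    then have "m * norm (P - Q) \<le> norm (resid lam A (P - Q))"
      by (rule m(2)[OF A])
    also have "\<dots> = norm (resid lam A P - resid lam A Q)"
      by (simp only: linear_diff[OF linear_resid])
    also have "\<dots> \<le> norm (resid lam A P) + norm (resid lam A Q)"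
      by (rule norm_triangle_ineq4)
    also have "norm (resid lam A P) \<le> sqrt c"
      using c by (simp add: objective_def real_le_rsqrt)
    also have "norm (resid lam A Q) \<le> b"
      using b A Q by simp
    finally have "norm (P - Q) \<le> (sqrt c + b) / m"
      using m(1) by (simp add: field_simps)
    then show ?thesis
      using Q norm_triangle_sub[of P Q] by linarith
  qed
  then have "{(A, P). feasible_A A \<and> feasible_P \<beta> P \<and> objective lam A P \<le> c}
     \<subseteq> cball 0 a \<times> cball 0 (norm (1 :: real ^ 'n ^ 'n) + (sqrt c + b) / m)"
    using a by auto
  then show ?thesis
    by (rule bounded_subset[OF bounded_Times[OF bounded_cball bounded_cball]])
qed

section \<open>Multipliers\<close>

text \<open>\<open>g\<close> stands for the derivative in \<open>P\<close>, nonnegative along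
  feasible directions. Shifts between two columns, within one row or compensated in a second row,
  already determine the multipliers.\<close>

lemma multipliers_P:
  fixes \<beta> :: "real ^ 'n::finite" and g :: "real ^ 'n ^ 'n \<Rightarrow> real"
  assumes \<beta>: "\<And>i. \<beta> $ i \<noteq> 0" and \<beta>1: "(\<Sum>i\<in>UNIV. \<beta> $ i) = 1" and P: "feasible_P \<beta> P"
    and g: "linear g" and dir: "\<And>t D. t > 0 \<Longrightarrow> feasible_P \<beta> (P + t *\<^sub>R D) \<Longrightarrow> 0 \<le> g D"
  obtains \<alpha> \<alpha>' :: "real ^ 'n" where
    "\<And>i j. g (matrix_unit i j) + \<alpha> $ i - \<alpha>' $ j * \<beta> $ i = 0"
    "\<And>j. \<alpha>' $ j * (\<Sum>l\<in>UNIV. \<beta> $ l * P $ l $ j) = 0" "\<And>j. 0 \<le> \<alpha>' $ j"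
proof -
  note lin_simps = linear_diff[OF linear_matrix_vector_mult_left] linear_scale[OF linear_matrix_vector_mult_left]
    linear_diff[OF linear_vector_matrix_mult_right] linear_scale[OF linear_vector_matrix_mult_right]
    linear_diff[OF g] linear_scale[OF g] matrix_unit_mult_one vector_mult_matrix_unit
  note add_simps = linear_add[OF linear_matrix_vector_mult_left] linear_scale[OF linear_matrix_vector_mult_left]
    linear_add[OF linear_vector_matrix_mult_right] linear_scale[OF linear_vector_matrix_mult_right]
  note nonneg = feasible_P_nonneg[OF P] and sum_one = feasible_P_sum_one[OF P \<beta>1]
  have P1: "P *v 1 = 1"
    using P by (simp add: feasible_P_def)
  \<comment> \<open>Complementary slackness will force the multiplier of such a column to be 0,
    which makes \<open>k\<close> a reference column.\<close>
  obtain k where "(\<beta> v* P) $ k \<noteq> 0"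
    using sum_one by (metis sum.not_neutral_contains_not_neutral zero_neq_one)
  then have k: "(\<beta> v* P) $ k > 0"
    using nonneg[of k] by simp
  \<comment> \<open>Stationarity asks for a splitting of \<open>h\<close> as a function of \<open>j\<close> minus a function of \<open>i\<close>,
    which is available because the mixed differences of \<open>h\<close> vanish.\<close>
  define h where "h i j = g (matrix_unit i j) / \<beta> $ i" for i j
  have cross: "h i j - h i l \<le> h i' j - h i' l" for i i' j l
  proof -
    \<comment> \<open>The weights \<open>1 / \<beta> $ i\<close> make the shifts in the two rows
      cancel in \<open>\<beta> v* ?D\<close>. Exchanging the roles of the indices turns the
      inequality into an equality.\<close>
    let ?D = "(1 / \<beta> $ i') *\<^sub>R (matrix_unit i' j - matrix_unit i' l) - (1 / \<beta> $ i) *\<^sub>R (matrix_unit i j - matrix_unit i l)"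
    have "\<beta> v* ?D = 0" "?D *v 1 = 0"
      by (simp_all only: lin_simps) (simp_all add: \<beta> scaleR_diff_right)
    then have "feasible_P \<beta> (P + 1 *\<^sub>R ?D)"
      using P by (simp only: feasible_P_def scaleR_one add_simps add_0_right)
    then have "0 \<le> g ?D" by (rule dir[rotated]) simp
    then show ?thesis by (simp only: lin_simps) (simp add: h_def diff_divide_distrib)
  qed
  have h_min: "h i l \<le> h i j" if l: "(\<beta> v* P) $ l > 0" for i j l
  proof -
    \<comment> \<open>This direction moves mass of \<open>\<beta> v* P\<close> from column
      \<open>l\<close> to column \<open>j\<close>; a step of length
      \<open>(\<beta> v* P) $ l\<close> empties column \<open>l\<close> and no more.\<close>
    let ?D = "(1 / \<beta> $ i) *\<^sub>R (matrix_unit i j - matrix_unit i l)"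
    have "\<beta> v* ?D = axis j 1 - axis l 1" "?D *v 1 = 0"
      by (simp_all only: lin_simps) (simp_all add: \<beta> scaleR_diff_right)
    then have "feasible_P \<beta> (P + (\<beta> v* P) $ l *\<^sub>R ?D)"
      using nonneg by (simp only: feasible_P_def add_simps P1) (auto simp: less_eq_vec_def axis_def)
    then have "0 \<le> g ?D" by (rule dir[OF l])
    then show ?thesis by (simp only: lin_simps) (simp add: h_def diff_divide_distrib)
  qed
  show ?thesis
  \<comment> \<open>The column \<open>k\<close> normalizes the splitting. Using \<open>k\<close> as
    the row index too is an arbitrary choice, since the differences do not depend on the
    row.\<close>
  proof (rule that[of "\<chi> i. - g (matrix_unit i k)" "\<chi> j. h k j - h k k"])
    fix i j
    have "h i j - h i k = h k j - h k k"
      using cross[of i j k k] cross[of k j k i] by simp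
    then have "(h k j - h k k) * \<beta> $ i = g (matrix_unit i j) - g (matrix_unit i k)"
      using \<beta>[of i] by (simp add: h_def field_simps)
    then show "g (matrix_unit i j) + (\<chi> i. - g (matrix_unit i k)) $ i - (\<chi> j. h k j - h k k) $ j * \<beta> $ i = 0"
      by simp
  next
    fix j
    \<comment> \<open>If column \<open>j\<close> also carries positive mass, \<open>h_min\<close>
      applies in both directions and the multiplier vanishes.\<close>
    show "(\<chi> j. h k j - h k k) $ j * (\<Sum>l\<in>UNIV. \<beta> $ l * P $ l $ j) = 0"
      using h_min[OF k, of k j] h_min[of j k k] nonneg[of j] by (auto simp: vector_matrix_mult_nth less_le)
    show "0 \<le> (\<chi> j. h k j - h k k) $ j"
      using h_min[OF k, of k j] by simp
  qed
qed

text \<open>The constraints act on single rows, so three moves suffice: raising an entry of a row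
  with slack, lowering a positive entry, and transferring mass from a positive entry to another one
  in its row.\<close>

lemma multipliers_A:
  fixes g :: "real ^ 'n ^ 'n \<Rightarrow> real" and A :: "real ^ 'n::finite ^ 'n"
  assumes A: "feasible_A A"
    and g: "linear g" and dir: "\<And>t D. t > 0 \<Longrightarrow> feasible_A (A + t *\<^sub>R D) \<Longrightarrow> 0 \<le> g D"
  obtains \<pi> :: "real ^ 'n" and \<pi>' :: "real ^ 'n ^ 'n" where
    "\<And>i j. g (matrix_unit i j) + \<pi> $ i - \<pi>' $ i $ j = 0"
    "\<And>i. \<pi> $ i * ((\<Sum>l\<in>UNIV. A $ i $ l) - 1) = 0"
    "\<And>i j. \<pi>' $ i $ j * A $ i $ j = 0" "\<And>i. 0 \<le> \<pi> $ i" "\<And>i j. 0 \<le> \<pi>' $ i $ j"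
proof -
  have nonneg: "0 \<le> A $ i $ j" and le1: "(\<Sum>j\<in>UNIV. A $ i $ j) \<le> 1" for i j
    using A by (auto simp: feasible_A_iff)
  have feas: "feasible_A (A + D)"
    if "\<And>i j. 0 \<le> A $ i $ j + D $ i $ j" "\<And>i. (\<Sum>j\<in>UNIV. A $ i $ j) + (D *v 1) $ i \<le> 1" for D
    using that by (auto simp: feasible_A_iff matrix_vector_mult_def sum.distrib)
  note lin_simps = linear_diff[OF linear_matrix_vector_mult_left] linear_neg[OF linear_matrix_vector_mult_left]
    linear_scale[OF linear_matrix_vector_mult_left] linear_neg[OF g] linear_diff[OF g] matrix_unit_mult_one
  have slack: "0 \<le> g (matrix_unit i j)" if "(\<Sum>j\<in>UNIV. A $ i $ j) < 1" for i j
  proof (rule dir)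
    let ?t = "1 - (\<Sum>j\<in>UNIV. A $ i $ j)"
    show "0 < ?t" using that by simp
    show "feasible_A (A + ?t *\<^sub>R matrix_unit i j)"
    proof (rule feas)
      show "0 \<le> A $ k $ l + (?t *\<^sub>R matrix_unit i j) $ k $ l" for k l
        using nonneg[of k l] that by (simp add: matrix_unit_nth)
      show "(\<Sum>j\<in>UNIV. A $ k $ j) + ((?t *\<^sub>R matrix_unit i j) *v 1) $ k \<le> 1" for k
        unfolding lin_simps using le1[of k] by (simp add: axis_def)
    qed
  qed
  have decr: "g (matrix_unit i j) \<le> 0" if "0 < A $ i $ j" for i j
  proof -
    have "feasible_A (A + A $ i $ j *\<^sub>R (- matrix_unit i j))"
    proof (rule feas)
      show "0 \<le> A $ k $ l + (A $ i $ j *\<^sub>R (- matrix_unit i j)) $ k $ l" for k l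
        using nonneg[of k l] by (simp add: matrix_unit_nth)
      show "(\<Sum>j\<in>UNIV. A $ k $ j) + ((A $ i $ j *\<^sub>R (- matrix_unit i j)) *v 1) $ k \<le> 1" for k
        unfolding lin_simps using le1[of k] le1[of i] that by (simp add: axis_def)
    qed
    from dir[OF that this] show ?thesis by (simp add: lin_simps)
  qed
  have exch: "g (matrix_unit i j) \<le> g (matrix_unit i l)" if "0 < A $ i $ j" for i j l
  proof -
    have "feasible_A (A + A $ i $ j *\<^sub>R (matrix_unit i l - matrix_unit i j))"
    proof (rule feas)
      show "0 \<le> A $ k $ m + (A $ i $ j *\<^sub>R (matrix_unit i l - matrix_unit i j)) $ k $ m" for k m
        using nonneg[of k m] that by (auto simp: matrix_unit_nth)
      show "(\<Sum>j\<in>UNIV. A $ k $ j) + ((A $ i $ j *\<^sub>R (matrix_unit i l - matrix_unit i j)) *v 1) $ k \<le> 1" for k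
        unfolding lin_simps using le1[of k] by simp
    qed
    from dir[OF that this] show ?thesis by (simp add: lin_simps)
  qed
  define mn where "mn i = Min (range (\<lambda>j. g (matrix_unit i j)))" for i
  have mn_le: "mn i \<le> g (matrix_unit i j)" for i j
    by (simp add: mn_def)
  have mn_in: "\<exists>j. mn i = g (matrix_unit i j)" for i
    using Min_in[of "range (\<lambda>j. g (matrix_unit i j))"] unfolding mn_def by fastforce
  show ?thesis
  \<comment> \<open>\<open>max 0 (- mn i)\<close> is the least nonnegative shift that makes all
    entries of row \<open>i\<close> of the gradient nonnegative; the shifted gradient is then the
    multiplier of the sign constraints.\<close>
  proof (rule that[of "\<chi> i. max 0 (- mn i)" "\<chi> i j. g (matrix_unit i j) + max 0 (- mn i)"])
    fix i
    have "mn i \<ge> 0" if "(\<Sum>l\<in>UNIV. A $ i $ l) < 1"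
      using slack[OF that] mn_in[of i] by metis
    then show "(\<chi> i. max 0 (- mn i)) $ i * ((\<Sum>l\<in>UNIV. A $ i $ l) - 1) = 0"
      using le1[of i] by (cases "(\<Sum>l\<in>UNIV. A $ i $ l) < 1") auto
    fix j
    \<comment> \<open>A positive entry sits where the gradient row attains its minimum, and this
      minimum is at most 0, so the shift cancels it exactly.\<close>
    have "g (matrix_unit i j) = mn i \<and> mn i \<le> 0" if "0 < A $ i $ j"
      using exch[OF that] decr[OF that] mn_in[of i] mn_le[of i j] by (metis order_antisym)
    then show "(\<chi> i j. g (matrix_unit i j) + max 0 (- mn i)) $ i $ j * A $ i $ j = 0"
      using nonneg[of i j] by (cases "A $ i $ j = 0") (auto simp: less_le)
    show "0 \<le> (\<chi> i j. g (matrix_unit i j) + max 0 (- mn i)) $ i $ j"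
      using mn_le[of i j] by simp
  qed auto
qed

text \<open>Each half of the KKT system involves the derivatives and constraints of one block only,
  so optimality in each block separately supplies its multipliers.\<close>

lemma KKT_of_blockwise_optimal:
  fixes lam \<beta> :: "real ^ 'n::finite"
  assumes \<beta>: "\<And>i. \<beta> $ i \<noteq> 0" and \<beta>1: "(\<Sum>i\<in>UNIV. \<beta> $ i) = 1"
    and A: "feasible_A A" and P: "feasible_P \<beta> P"
    and optP: "\<And>Q. feasible_P \<beta> Q \<Longrightarrow> objective lam A P \<le> objective lam A Q"
    and optA: "\<And>B. feasible_A B \<Longrightarrow> objective lam A P \<le> objective lam B P"
  shows "KKT_OP lam \<beta> A P"
proof -
  let ?R = "resid lam A P"
  let ?g = "\<lambda>D. 2 * (?R \<bullet> resid lam A D)" and ?h = "\<lambda>D. 2 * (?R \<bullet> (P ** D))"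
  note affP = linear_resid linear_add[OF linear_resid]
  have affA: "resid lam (X + D) P = resid lam X P + P ** D" for X D
    by (simp add: matrix_add_ldistrib)
  have g: "linear ?g"
    by (rule linearI) (simp_all only: linear_add[OF linear_resid] linear_scale[OF linear_resid]
       inner_add_right inner_scaleR_right distrib_left real_scaleR_def mult.left_commute)
  have h: "linear ?h"
    by (rule linearI) (simp_all only: linear_add[OF linear_matrix_mult_right]
       linear_scale[OF linear_matrix_mult_right]
       inner_add_right inner_scaleR_right distrib_left real_scaleR_def mult.left_commute)
  have dirP: "0 \<le> ?g D" if "t > 0" "feasible_P \<beta> (P + t *\<^sub>R D)" for t D
  proof -
    have "0 \<le> ?R \<bullet> resid lam A D"
      by (rule first_order_condition[OF affP convex_feasible_P, where t = t])
         (use that P optP in \<open>auto simp: objective_def\<close>)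
    then show ?thesis by simp
  qed
  obtain \<alpha> \<alpha>' where \<alpha>: "\<And>i j. ?g (matrix_unit i j) + \<alpha> $ i - \<alpha>' $ j * \<beta> $ i = 0"
    "\<And>j. \<alpha>' $ j * (\<Sum>l\<in>UNIV. \<beta> $ l * P $ l $ j) = 0" "\<And>j. 0 \<le> \<alpha>' $ j"
    by (rule multipliers_P[OF \<beta> \<beta>1 P g], erule (1) dirP) (rule that)
  have dirA: "0 \<le> ?h D" if "t > 0" "feasible_A (A + t *\<^sub>R D)" for t D
  proof -
    have "0 \<le> ?R \<bullet> (P ** D)"
      by (rule first_order_condition[OF linear_matrix_mult_right affA convex_feasible_A, where t = t])
         (use that A optA in \<open>auto simp: objective_def\<close>)
    then show ?thesis by simp
  qed
  obtain \<pi> \<pi>' where \<pi>: "\<And>i j. ?h (matrix_unit i j) + \<pi> $ i - \<pi>' $ i $ j = 0"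
    "\<And>i. \<pi> $ i * ((\<Sum>l\<in>UNIV. A $ i $ l) - 1) = 0"
    "\<And>i j. \<pi>' $ i $ j * A $ i $ j = 0" "\<And>i. 0 \<le> \<pi> $ i" "\<And>i j. 0 \<le> \<pi>' $ i $ j"
    by (rule multipliers_A[OF A h], erule (1) dirA) (rule that)
  have "entry_deriv (\<lambda>P. objective lam A P) P i j = ?g (matrix_unit i j)" for i j
    unfolding objective_def by (rule entry_deriv_norm_square[OF affP])
  moreover have "entry_deriv (\<lambda>A. objective lam A P) A i j = ?h (matrix_unit i j)" for i j
    unfolding objective_def by (rule entry_deriv_norm_square[OF linear_matrix_mult_right affA])
  ultimately show ?thesis
    unfolding KKT_OP_def
    by (intro exI[of _ \<alpha>] exI[of _ \<alpha>'] exI[of _ \<pi>] exI[of _ \<pi>'])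
       (use \<alpha> \<pi> A P in \<open>simp add: feasible_A_def feasible_P_def\<close>)
qed

section \<open>Local maxima\<close>

lemma not_local_max:
  fixes lam \<beta> :: "real ^ 'n::finite"
  assumes inj: "inj (($) lam)" and \<beta>: "\<And>i. \<beta> $ i \<noteq> 0" and card: "2 \<le> CARD('n)"
  shows "\<not> local_max_on (\<lambda>(A, P). objective lam A P) (feasible_OP \<beta>) (A, P)"
proof
  assume "local_max_on (\<lambda>(A, P). objective lam A P) (feasible_OP \<beta>) (A, P)"
  then obtain e where A: "feasible_A A" and P: "feasible_P \<beta> P" and e: "e > 0"
    and max: "\<And>Q. feasible_P \<beta> Q \<Longrightarrow> dist Q P < e \<Longrightarrow> objective lam A Q \<le> objective lam A P"
    by (auto simp: local_max_on_def feasible_OP_def dist_Pair_Pair)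
  obtain i j :: 'n where ij: "i \<noteq> j"
    using card by (metis (full_types) card_le_Suc0_iff_eq finite not_less_eq_eq numeral_2_eq_2 UNIV_I)
  \<comment> \<open>A rank-one direction: the column with entries \<open>1 / \<beta> $ i\<close> and
    \<open>- 1 / \<beta> $ j\<close> times the row \<open>axis i 1 - axis j 1\<close>. Both factors
    are chosen to preserve the constraints on \<open>P\<close>.\<close>
  define D where "D = (1 / \<beta> $ i) *\<^sub>R (matrix_unit i i - matrix_unit i j) - (1 / \<beta> $ j) *\<^sub>R (matrix_unit j i - matrix_unit j j)"
  note lin_simps = linear_diff[OF linear_matrix_vector_mult_left] linear_add[OF linear_matrix_vector_mult_left]
    linear_scale[OF linear_matrix_vector_mult_left] linear_diff[OF linear_vector_matrix_mult_right] linear_add[OF linear_vector_matrix_mult_right]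
    linear_scale[OF linear_vector_matrix_mult_right] matrix_unit_mult_one vector_mult_matrix_unit
  have D1: "D *v 1 = 0" and \<beta>D: "\<beta> v* D = 0"
    unfolding D_def by (simp_all add: lin_simps \<beta> scaleR_diff_right)
  have "D $ i $ i = 1 / \<beta> $ i"
    using ij by (simp add: D_def matrix_unit_nth)
  then have "D \<noteq> 0"
    using \<beta>[of i] by auto
  then have q: "0 < (norm (resid lam A D))\<^sup>2"
    using resid_kernel_trivial[OF inj \<beta> \<beta>D, of A] by auto
  define t where "t = e / (2 * norm D)"
  have t: "0 < t" "t * norm D < e"
    using e \<open>D \<noteq> 0\<close> by (auto simp: t_def)
  have "objective lam A (P + s *\<^sub>R D) \<le> objective lam A P" if "s = t \<or> s = - t" for s
  proof (rule max)
    show "feasible_P \<beta> (P + s *\<^sub>R D)"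
      using P by (simp add: feasible_P_def lin_simps D1 \<beta>D)
    show "dist (P + s *\<^sub>R D) P < e"
      using t that by (auto simp: dist_norm)
  qed
  \<comment> \<open>Adding the two inequalities cancels the linear terms.\<close>
  from this[of t] this[of "- t"] have "t\<^sup>2 * (norm (resid lam A D))\<^sup>2 \<le> 0"
    unfolding objective_def norm_square_affine[OF linear_resid linear_add[OF linear_resid]]
    by simp
  then show False
    using q t(1) by (simp add: mult_le_0_iff)
qed

section \<open>The alternating minimization algorithm\<close>

lemma tendsto_objective:
  assumes "(A \<longlongrightarrow> a) F" "(P \<longlongrightarrow> p) F"
  shows "((\<lambda>l. objective lam (A l) (P l)) \<longlongrightarrow> objective lam a p) F"
proof -
  have "isCont (\<lambda>(A, P). resid lam A P) (a, p)"
    using continuous_on_resid[of UNIV lam] by (simp add: continuous_on_eq_continuous_at)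
  from isCont_tendsto_compose[OF this tendsto_Pair[OF assms]]
  have "((\<lambda>l. resid lam (A l) (P l)) \<longlongrightarrow> resid lam a p) F" by simp
  then show ?thesis
    unfolding objective_def by (intro tendsto_power tendsto_norm)
qed

context
  fixes lam \<beta> :: "real ^ 'n::finite" and A P :: "nat \<Rightarrow> real ^ 'n ^ 'n"
  assumes alt: "alternating_minimization lam \<beta> A P"
begin

lemma iterates_feasible: "feasible_A (A l)" "feasible_P \<beta> (P l)"
  using alt by (cases l; auto simp: alternating_minimization_def optimal_P_def optimal_A_def is_arg_min_def)+

lemma iterate_P_le: "feasible_P \<beta> Q \<Longrightarrow> objective lam (A l) (P l) \<le> objective lam (A l) Q"
  using alt by (auto simp: alternating_minimization_def optimal_P_def is_arg_min_linorder)

lemma iterate_A_le: "feasible_A B \<Longrightarrow> objective lam (A (Suc l)) (P l) \<le> objective lam B (P l)"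
  using alt by (auto simp: alternating_minimization_def optimal_A_def is_arg_min_linorder)

text \<open>Updating \<open>A\<close> with \<open>P\<close> fixed and then \<open>P\<close> with the
  new \<open>A\<close> fixed can only lower the objective, since the previous iterate remains a
  competitor.\<close>

lemma decseq_objective: "decseq (\<lambda>l. objective lam (A l) (P l))"
  by (rule decseq_SucI)
    (blast intro: order_trans iterate_P_le iterate_A_le iterates_feasible)

text \<open>Optimality in \<open>P\<close> passes to the limit directly. Optimality in
  \<open>A\<close> compares \<open>P l\<close> with the next iterate \<open>A (Suc l)\<close>, which
  need not converge along the subsequence; the bound by the limit value \<open>L\<close> replaces
  it.\<close>

lemma limit_point_blockwise_optimal:
  assumes lim: "(\<lambda>l. objective lam (A l) (P l)) \<longlonglongrightarrow> L"
    and lp: "limit_point_of (a, p) (\<lambda>l. (A l, P l))"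
  shows "feasible_A a" "feasible_P \<beta> p" "objective lam a p = L"
    and "feasible_P \<beta> Q \<Longrightarrow> L \<le> objective lam a Q"
    and "feasible_A B \<Longrightarrow> L \<le> objective lam B p"
proof -
  obtain r where r: "strict_mono r" "(\<lambda>l. (A (r l), P (r l))) \<longlonglongrightarrow> (a, p)"
    using lp by (auto simp: limit_point_of_def o_def)
  have a: "(\<lambda>l. A (r l)) \<longlonglongrightarrow> a" and p: "(\<lambda>l. P (r l)) \<longlonglongrightarrow> p"
    using tendsto_fst[OF r(2)] tendsto_snd[OF r(2)] by simp_all
  have Lr: "(\<lambda>l. objective lam (A (r l)) (P (r l))) \<longlonglongrightarrow> L"
    using LIMSEQ_subseq_LIMSEQ[OF lim r(1)] by (simp add: o_def)
  show "feasible_A a"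
    using closed_sequentially[OF closed_feasible_A _ a] iterates_feasible by simp
  show "feasible_P \<beta> p"
    using closed_sequentially[OF closed_feasible_P _ p] iterates_feasible by simp
  show "objective lam a p = L"
    using tendsto_objective[OF a p] Lr by (rule LIMSEQ_unique)
  show "L \<le> objective lam a Q" if "feasible_P \<beta> Q"
    using Lr tendsto_objective[OF a tendsto_const] by (rule LIMSEQ_le) (auto intro: iterate_P_le that)
  show "L \<le> objective lam B p" if "feasible_A B"
  proof (rule tendsto_lowerbound[OF tendsto_objective[OF tendsto_const p]])
    have "L \<le> objective lam B (P l)" for l
    proof -
      have "L \<le> objective lam (A (Suc l)) (P (Suc l))"
        using decseq_ge[OF decseq_objective lim] .
      also have "\<dots> \<le> objective lam (A (Suc l)) (P l)"
        by (intro iterate_P_le iterates_feasible)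
      also have "\<dots> \<le> objective lam B (P l)"
        by (rule iterate_A_le[OF that])
      finally show ?thesis .
    qed
    then show "\<forall>\<^sub>F l in sequentially. L \<le> objective lam B (P (r l))" by simp
  qed simp
qed

text \<open>By monotonicity all iterates stay in the sublevel set of the initial value, which is
  bounded.\<close>

lemma limit_point_exists:
  assumes "inj (($) lam)" "\<And>i. \<beta> $ i \<noteq> 0" "(\<Sum>i\<in>UNIV. \<beta> $ i) = 1"
  shows "\<exists>a p. limit_point_of (a, p) (\<lambda>l. (A l, P l))"
proof -
  have "range (\<lambda>l. (A l, P l))
    \<subseteq> {(B, Q). feasible_A B \<and> feasible_P \<beta> Q \<and> objective lam B Q \<le> objective lam (A 0) (P 0)}"
    using iterates_feasible decseqD[OF decseq_objective] by auto
  then have "bounded (range (\<lambda>l. (A l, P l)))"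
    by (rule bounded_subset[OF bounded_sublevel[OF assms]])
  then obtain x r where "strict_mono r" "((\<lambda>l. (A l, P l)) \<circ> r) \<longlonglongrightarrow> x"
    using bounded_imp_convergent_subsequence by blast
  then have "limit_point_of (fst x, snd x) (\<lambda>l. (A l, P l))"
    unfolding limit_point_of_def prod.collapse by blast
  then show ?thesis
    by blast
qed

end

theorem theorem1:
  fixes lam \<beta> :: "real ^ 'n::{finite, linorder}"
    and A P :: "nat \<Rightarrow> real ^ 'n::{finite, linorder} ^ 'n::{finite, linorder}"
  assumes "2 \<le> CARD('n::{finite, linorder})"
    and "lam $ Min UNIV < 1"
    and "\<And>i j. i < j \<Longrightarrow> lam $ j < lam $ i"
    and "lam $ Min UNIV > (MAX l\<in>UNIV - {Min UNIV}. \<bar>lam $ l\<bar>)"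
    and "(\<Sum>l\<in>UNIV. \<beta> $ l) = 1"
    and "(\<Prod>l\<in>UNIV. \<beta> $ l) \<noteq> 0"
    and "alternating_minimization lam \<beta> A P"
  shows "\<exists>Linf :: real.
           (\<lambda>l. objective lam (A l) (P l)) \<longlonglongrightarrow> Linf \<and>
           (\<exists>Ainf Pinf. limit_point_of (Ainf, Pinf) (\<lambda>l. (A l, P l))) \<and>
           (\<forall>Ainf Pinf. limit_point_of (Ainf, Pinf) (\<lambda>l. (A l, P l)) \<longrightarrow>
              KKT_OP lam \<beta> Ainf Pinf \<and> objective lam Ainf Pinf = Linf) \<and>
           (\<forall>Ainf Pinf. limit_point_of (Ainf, Pinf) (\<lambda>l. (A l, P l)) \<longrightarrow>
              \<not> local_max_on (\<lambda>(A, P). objective lam A P) (feasible_OP \<beta>) (Ainf, Pinf))"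
proof -
  note alt = assms(7)
  have inj: "inj (($) lam)"
    using assms(3) by (metis injI less_irrefl neq_iff)
  have \<beta>: "\<beta> $ i \<noteq> 0" for i
    using assms(6) by simp
  \<comment> \<open>The values decrease and, being squares, are bounded below by 0.\<close>
  obtain L where L: "(\<lambda>l. objective lam (A l) (P l)) \<longlonglongrightarrow> L"
    using decseq_convergent[OF decseq_objective[OF alt], of 0] by (auto simp: objective_def)
  have "KKT_OP lam \<beta> a p \<and> objective lam a p = L" if "limit_point_of (a, p) (\<lambda>l. (A l, P l))" for a p
    using limit_point_blockwise_optimal[OF alt L that]
    by (auto intro!: KKT_of_blockwise_optimal \<beta> assms(5))
  then show ?thesis
    using L limit_point_exists[OF alt inj \<beta> assms(5)] not_local_max[OF inj \<beta> assms(1)] by blast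
qed

end
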